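(* The $\mathbb F$-algebra $\Re$ has a presentation given by generators $A,D,B,\alpha,\beta,\delta$ and relations $$BA=AB-2D,$$ $$DA=AD+A\delta-A^2-2AB+2D-\alpha,$$ $$BD=DB+B\delta-B^2-2AB+2D+\beta,$$ $$\alpha A=A\alpha,\quad \beta A=A\beta,\quad \delta A=A\delta,\qquad \alpha B=B\alpha,\quad \beta B=B\beta,\quad \delta B=B\delta,$$ $$\alpha\delta=\delta\alpha,\qquad \beta\delta=\delta\beta.$$ That is, the $\mathbb F$-algebra defined by these generators and relations is isomorphic to $\Re$ via the map sending each generator to the element of $\Re$ of the same name.
   Context: $\mathbb F$ is a field with $\operatorname{char}\mathbb F\neq 2$. All algebras are unital and associative. Write $[x,y]=xy-yx$. The Racah algebra $\Re$ is the $\mathbb F$-algebra defined by generators $A,B,C,D$ and the relations $[A,B]=[B,C]=[C,A]=2D$ together with the relations asserting that each of the elements $$\alpha=[A,D]+AC-BA,\qquad \beta=[B,D]+BA-CB,\qquad \gamma=[C,D]+CB-AC$$ is central in $\Re$. Set $\delta=A+B+C$. *)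

theory Defs
  imports "HOL-Algebra.QuotRing" "HOL-Algebra.Module" "HOL-Library.Poly_Mapping"
begin

section \<open>Free associative algebras\<close>

text \<open>
  The free monoid on \<open>'g\<close>, written additively: multiplication in \<open>'m \<Rightarrow>\<^sub>0 'k\<close> is
  convolution with respect to the (not necessarily commutative) addition of \<open>'m\<close>, so that
  \<open>'g free_word \<Rightarrow>\<^sub>0 'k\<close> is the monoid algebra of the free monoid, i.e. the algebra of
  noncommutative polynomials in the generators \<open>'g\<close>.
\<close>

datatype 'g free_word = Word (letters: "'g list")

instantiation free_word :: (type) monoid_add
begin

definition zero_free_word :: "'a free_word" where
  "0 = Word []"

definition plus_free_word :: "'a free_word \<Rightarrow> 'a free_word \<Rightarrow> 'a free_word" where
  "u + v = Word (letters u @ letters v)"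

instance
  by standard (simp_all add: zero_free_word_def plus_free_word_def)

end

type_synonym ('g, 'k) free_alg = "'g free_word \<Rightarrow>\<^sub>0 'k"

definition free_gen :: "'g \<Rightarrow> ('g, 'k::field) free_alg" where
  "free_gen g = Poly_Mapping.single (Word [g]) 1"

definition free_algebra :: "('k, ('g, 'k::field) free_alg) module" where
  "free_algebra =
    \<lparr>carrier = UNIV, mult = (*), one = 1, zero = 0, add = (+),
     smult = (\<lambda>c. Poly_Mapping.map ((*) c))\<rparr>"

lemma ring_free_algebra: "ring (free_algebra :: ('k, ('g, 'k::field) free_alg) module)"
proof (rule ringI)
  show "abelian_group (free_algebra :: ('k, ('g, 'k) free_alg) module)"
    by (rule abelian_groupI)
      (auto simp: free_algebra_def add.assoc add.commute intro: exI[of _ "- x" for x] add.left_inverse)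
  show "Group.monoid (free_algebra :: ('k, ('g, 'k) free_alg) module)"
    by (rule monoidI) (auto simp: free_algebra_def mult.assoc)
qed (auto simp: free_algebra_def distrib_left distrib_right)


section \<open>Algebras given by generators and relations\<close>

text \<open>
  A relation \<open>l = r\<close> is encoded as the pair \<open>(l, r)\<close>. The \<open>ideal\<close> of HOL-Algebra, and hence the
  ideal generated by a set, is two-sided.
\<close>

definition relation_ideal ::
  "(('g, 'k::field) free_alg \<times> ('g, 'k) free_alg) set \<Rightarrow> ('g, 'k) free_alg set" where
  "relation_ideal E = Idl\<^bsub>free_algebra\<^esub> {l - r | l r. (l, r) \<in> E}"

definition presented_algebra ::
  "(('g, 'k::field) free_alg \<times> ('g, 'k) free_alg) set \<Rightarrow> ('k, ('g, 'k) free_alg set) module" where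
  "presented_algebra E =
    ring.extend (free_algebra Quot relation_ideal E)
      (module.fields
        (\<lambda>c X. \<Union>x\<in>X. relation_ideal E +>\<^bsub>free_algebra\<^esub> (c \<odot>\<^bsub>free_algebra\<^esub> x)))"

definition presented_class ::
  "(('g, 'k::field) free_alg \<times> ('g, 'k) free_alg) set \<Rightarrow> ('g, 'k) free_alg \<Rightarrow>
    ('g, 'k) free_alg set" where
  "presented_class E x = relation_ideal E +>\<^bsub>free_algebra\<^esub> x"

text \<open>
  The scalars range over the whole type \<open>'k\<close>. The locale \<open>algebra\<close> of HOL-Algebra is not used
  because it requires commutative multiplication.
\<close>

definition algebra_iso :: "('k, 'a) module \<Rightarrow> ('k, 'b) module \<Rightarrow> ('a \<Rightarrow> 'b) set" where
  "algebra_iso S T =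
    {\<phi> \<in> ring_iso S T. \<forall>c. \<forall>x\<in>carrier S. \<phi> (c \<odot>\<^bsub>S\<^esub> x) = c \<odot>\<^bsub>T\<^esub> \<phi> x}"


section \<open>The Racah algebra\<close>

definition commutator :: "'a::ring \<Rightarrow> 'a \<Rightarrow> 'a" where
  "commutator x y = x * y - y * x"

datatype racah_gen = Gen_A | Gen_B | Gen_C | Gen_D

type_synonym 'k racah_free = "(racah_gen, 'k) free_alg"

definition racah_A :: "'k::field racah_free" where "racah_A = free_gen Gen_A"
definition racah_B :: "'k::field racah_free" where "racah_B = free_gen Gen_B"
definition racah_C :: "'k::field racah_free" where "racah_C = free_gen Gen_C"
definition racah_D :: "'k::field racah_free" where "racah_D = free_gen Gen_D"

definition racah_alpha :: "'k::field racah_free" where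
  "racah_alpha = commutator racah_A racah_D + racah_A * racah_C - racah_B * racah_A"

definition racah_beta :: "'k::field racah_free" where
  "racah_beta = commutator racah_B racah_D + racah_B * racah_A - racah_C * racah_B"

definition racah_gamma :: "'k::field racah_free" where
  "racah_gamma = commutator racah_C racah_D + racah_C * racah_B - racah_A * racah_C"

definition racah_delta :: "'k::field racah_free" where
  "racah_delta = racah_A + racah_B + racah_C"

definition racah_relations :: "('k::field racah_free \<times> 'k racah_free) set" where
  "racah_relations =
    {(commutator racah_A racah_B, 2 * racah_D),
     (commutator racah_B racah_C, 2 * racah_D),
     (commutator racah_C racah_A, 2 * racah_D)}
    \<union> {(z * x, x * z) | z x. z \<in> {racah_alpha, racah_beta, racah_gamma}}"

definition racah_algebra :: "('k::field, 'k racah_free set) module" where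
  "racah_algebra = presented_algebra racah_relations"


section \<open>The second presentation\<close>

datatype adb_gen = Adb_A | Adb_D | Adb_B | Adb_alpha | Adb_beta | Adb_delta

type_synonym 'k adb_free = "(adb_gen, 'k) free_alg"

definition adb_relations :: "('k::field adb_free \<times> 'k adb_free) set" where
  "adb_relations =
    (let A = free_gen Adb_A; D = free_gen Adb_D; B = free_gen Adb_B;
         \<alpha> = free_gen Adb_alpha; \<beta> = free_gen Adb_beta; \<delta> = free_gen Adb_delta
     in {(B * A, A * B - 2 * D),
         (D * A, A * D + A * \<delta> - A ^ 2 - 2 * A * B + 2 * D - \<alpha>),
         (B * D, D * B + B * \<delta> - B ^ 2 - 2 * A * B + 2 * D + \<beta>),
         (\<alpha> * A, A * \<alpha>), (\<beta> * A, A * \<beta>), (\<delta> * A, A * \<delta>),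
         (\<alpha> * B, B * \<alpha>), (\<beta> * B, B * \<beta>), (\<delta> * B, B * \<delta>),
         (\<alpha> * \<delta>, \<delta> * \<alpha>), (\<beta> * \<delta>, \<delta> * \<beta>)})"

definition adb_algebra :: "('k::field, 'k adb_free set) module" where
  "adb_algebra = presented_algebra adb_relations"

end

theory Submission
  imports Defs
begin

text \<open>
  The map \<open>C \<mapsto> \<delta> - A - B\<close> inverts \<open>\<delta> \<mapsto> A + B + C\<close>, and both maps respect the defining
  relations. The only point beyond expansion is that the images of \<open>\<alpha>\<close>, \<open>\<beta>\<close>, \<open>\<gamma>\<close> are central in
  the algebra given by the second presentation: there \<open>D = (AB - BA)/2\<close>, so whatever commutes
  with \<open>A\<close> and \<open>B\<close> commutes with \<open>D\<close>; the relation for \<open>DA\<close> then writes \<open>\<alpha>\<close> in terms of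
  \<open>A, B, D, \<delta>\<close>, so \<open>\<alpha>\<close> commutes with \<open>\<beta>\<close>; and \<open>\<alpha> + \<beta> + \<gamma> = [\<delta>, D] = 0\<close>.
\<close>

section \<open>Homomorphisms of free algebras\<close>

text \<open>The algebra homomorphism given by the universal property of the free algebra. A scalar
  \<open>c\<close> enters as the constant \<open>Poly_Mapping.single 0 c\<close>, so that linearity
  becomes compatibility with products.\<close>

definition free_hom ::
  "('g \<Rightarrow> ('h, 'k) free_alg) \<Rightarrow> ('g, 'k::field) free_alg \<Rightarrow> ('h, 'k) free_alg" where
  "free_hom f p = (\<Sum>w\<in>Poly_Mapping.keys p.
     Poly_Mapping.single 0 (Poly_Mapping.lookup p w) * prod_list (map f (letters w)))"

text \<open>Words outside the support contribute zero, so sums for different polynomials can be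
  taken over a common index set.\<close>

lemma free_hom_superset:
  assumes "finite S" "Poly_Mapping.keys p \<subseteq> S"
  shows "free_hom f p = (\<Sum>w\<in>S.
    Poly_Mapping.single 0 (Poly_Mapping.lookup p w) * prod_list (map f (letters w)))"
  unfolding free_hom_def using assms
  by (intro sum.mono_neutral_left) (auto simp: in_keys_iff)

lemma free_hom_add [simp]: "free_hom f (p + q) = free_hom f p + free_hom f q"
proof -
  let ?S = "Poly_Mapping.keys p \<union> Poly_Mapping.keys q"
  have "Poly_Mapping.keys (p + q) \<subseteq> ?S" by (rule keys_add)
  then show ?thesis
    by (simp add: free_hom_superset[of ?S] lookup_add single_add distrib_right sum.distrib)
qed

lemma free_hom_0 [simp]: "free_hom f 0 = 0"
  by (simp add: free_hom_def)

lemma free_hom_uminus [simp]: "free_hom f (- p) = - free_hom f p"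
  using free_hom_add[of f p "- p"] by (simp add: eq_neg_iff_add_eq_0 add.commute)

lemma free_hom_diff [simp]: "free_hom f (p - q) = free_hom f p - free_hom f q"
  using free_hom_add[of f p "- q"] by simp

lemma free_hom_single:
  "free_hom f (Poly_Mapping.single w c) = Poly_Mapping.single 0 c * prod_list (map f (letters w))"
  by (cases "c = 0") (simp_all add: free_hom_def)

lemma free_hom_const [simp]: "free_hom f (Poly_Mapping.single 0 c) = Poly_Mapping.single 0 c"
  by (simp add: free_hom_single zero_free_word_def)

lemma free_hom_one [simp]: "free_hom f 1 = 1"
  using free_hom_const[of f 1] by simp

lemma free_hom_gen [simp]: "free_hom f (free_gen g) = f g"
  by (simp add: free_gen_def free_hom_single)

lemma free_hom_numeral [simp]: "free_hom f (numeral n) = numeral n"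
  using free_hom_const[of f "numeral n"] by simp

lemma poly_mapping_eq_sum_single:
  fixes p :: "'m \<Rightarrow>\<^sub>0 'c::comm_monoid_add"
  shows "p = (\<Sum>w\<in>Poly_Mapping.keys p. Poly_Mapping.single w (Poly_Mapping.lookup p w))"
proof (rule poly_mapping_eqI)
  fix k
  have "(\<Sum>w\<in>Poly_Mapping.keys p. if w = k then Poly_Mapping.lookup p w else 0) = Poly_Mapping.lookup p k"
    by (simp add: sum.delta in_keys_iff)
  then show "Poly_Mapping.lookup p k =
      Poly_Mapping.lookup (\<Sum>w\<in>Poly_Mapping.keys p. Poly_Mapping.single w (Poly_Mapping.lookup p w)) k"
    by (simp add: lookup_sum lookup_single when_def)
qed

lemma poly_mapping_add_induct [case_names zero single add]:
  fixes p :: "'m \<Rightarrow>\<^sub>0 'c::comm_monoid_add"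
  assumes "P 0" "\<And>w c. P (Poly_Mapping.single w c)" "\<And>p q. P p \<Longrightarrow> P q \<Longrightarrow> P (p + q)"
  shows "P p"
proof -
  have "P (\<Sum>w\<in>S. Poly_Mapping.single w (Poly_Mapping.lookup p w))" if "finite S" for S
    using that by (induction S) (auto intro: assms)
  then show ?thesis
    by (subst poly_mapping_eq_sum_single) simp
qed

text \<open>On monomials this holds because the empty word is neutral on both sides and the
  coefficients commute.\<close>

lemma const_commute:
  fixes p :: "'m::monoid_add \<Rightarrow>\<^sub>0 'k::field"
  shows "Poly_Mapping.single 0 c * p = p * Poly_Mapping.single 0 c"
  by (induction p rule: poly_mapping_add_induct)
    (simp_all add: mult_single distrib_left distrib_right mult.commute)

text \<open>Both sides are additive in each factor, which leaves two monomials. Words concatenate,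
  and the second scalar moves left past the image of the first word.\<close>

lemma free_hom_mult [simp]: "free_hom f (p * q) = free_hom f p * free_hom f q"
proof (induction p rule: poly_mapping_add_induct)
  case (single v c)
  show ?case
  proof (induction q rule: poly_mapping_add_induct)
    case (single w d)
    have "Poly_Mapping.single 0 c * prod_list (map f (letters v)) *
        (Poly_Mapping.single 0 d * prod_list (map f (letters w))) =
      Poly_Mapping.single 0 c * (Poly_Mapping.single 0 d * prod_list (map f (letters v))) *
        prod_list (map f (letters w))"
      by (metis (no_types) const_commute mult.assoc)
    also have "\<dots> = Poly_Mapping.single 0 (c * d) *
        (prod_list (map f (letters v)) * prod_list (map f (letters w)))"
      by (simp add: mult_single flip: mult.assoc)
    finally show ?case
      by (simp add: mult_single free_hom_single plus_free_word_def)
  qed (simp_all add: distrib_left)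
qed (simp_all add: distrib_right)

text \<open>Constants and generators generate the free algebra as a ring: a monomial is built from
  its coefficient by appending letters on the right.\<close>

lemma free_alg_induct [case_names const gen add mult]:
  fixes p :: "('g, 'k::field) free_alg"
  assumes const: "\<And>c. P (Poly_Mapping.single 0 c)"
    and gen: "\<And>g. P (free_gen g)"
    and add: "\<And>p q. P p \<Longrightarrow> P q \<Longrightarrow> P (p + q)"
    and mult: "\<And>p q. P p \<Longrightarrow> P q \<Longrightarrow> P (p * q)"
  shows "P p"
proof (induction p rule: poly_mapping_add_induct)
  case zero
  show ?case using const[of 0] by simp
next
  case (single w c)
  have "P (Poly_Mapping.single (Word gs) c)" for gs
  proof (induction gs rule: rev_induct)
    case Nil
    show ?case using const[of c] by (simp add: zero_free_word_def)
  next
    case (snoc g gs)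
    have "Poly_Mapping.single (Word (gs @ [g])) c = Poly_Mapping.single (Word gs) c * free_gen g"
      by (simp add: free_gen_def mult_single plus_free_word_def)
    then show ?case using mult[OF snoc gen] by simp
  qed
  then show ?case by (cases w) simp
qed (rule add)

section \<open>Presented algebras\<close>

lemma ideal_relation_ideal: "ideal (relation_ideal E) free_algebra"
  unfolding relation_ideal_def
  by (rule ring.genideal_ideal[OF ring_free_algebra]) (simp add: free_algebra_def)

lemma relation_ideal_zero [simp]: "0 \<in> relation_ideal E"
  using additive_subgroup.zero_closed[OF ideal.axioms(1)[OF ideal_relation_ideal[of E]]]
  by (simp add: free_algebra_def)

lemma relation_ideal_add: "x \<in> relation_ideal E \<Longrightarrow> y \<in> relation_ideal E \<Longrightarrow> x + y \<in> relation_ideal E"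
  using additive_subgroup.a_closed[OF ideal.axioms(1)[OF ideal_relation_ideal[of E]]]
  by (simp add: free_algebra_def)

lemma relation_ideal_mult_left: "x \<in> relation_ideal E \<Longrightarrow> y * x \<in> relation_ideal E"
  using ideal.I_l_closed[OF ideal_relation_ideal[of E], of x y] by (simp add: free_algebra_def)

lemma relation_ideal_mult_right: "x \<in> relation_ideal E \<Longrightarrow> x * y \<in> relation_ideal E"
  using ideal.I_r_closed[OF ideal_relation_ideal[of E], of x y] by (simp add: free_algebra_def)

lemma relation_ideal_uminus: "x \<in> relation_ideal E \<Longrightarrow> - x \<in> relation_ideal E"
  using relation_ideal_mult_left[of x E "- 1"] by simp

lemma relation_ideal_diff: "x \<in> relation_ideal E \<Longrightarrow> y \<in> relation_ideal E \<Longrightarrow> x - y \<in> relation_ideal E"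
  using relation_ideal_add[of x E "- y"] by (simp add: relation_ideal_uminus)

lemma relation_ideal_relation: "(l, r) \<in> E \<Longrightarrow> l - r \<in> relation_ideal E"
  unfolding relation_ideal_def
  by (rule subsetD[OF ring.genideal_self[OF ring_free_algebra]]) (auto simp: free_algebra_def)

text \<open>The preimage of an ideal under a ring homomorphism is an ideal. Here it contains the
  generators of \<open>relation_ideal E\<close>, hence all of it.\<close>

lemma free_hom_relation_ideal:
  assumes rel: "\<And>l r. (l, r) \<in> E \<Longrightarrow> free_hom f l - free_hom f r \<in> relation_ideal E'"
    and x: "x \<in> relation_ideal E"
  shows "free_hom f x \<in> relation_ideal E'"
proof -
  have "ring_hom_ring free_algebra free_algebra (free_hom f)"
    by (intro ring_hom_ringI ring_free_algebra) (auto simp: free_algebra_def)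
  from ring_hom_ring.ideal_vimage[OF this ideal_relation_ideal[of E']]
  have "ideal {y. free_hom f y \<in> relation_ideal E'} free_algebra"
    by (simp add: free_algebra_def)
  then have "relation_ideal E \<subseteq> {y. free_hom f y \<in> relation_ideal E'}"
    unfolding relation_ideal_def[of E]
    by (rule ring.genideal_minimal[OF ring_free_algebra]) (auto dest: rel)
  with x show ?thesis by auto
qed

section \<open>Cosets and the operations on them\<close>

lemma presented_class_eq_image: "presented_class E x = (\<lambda>i. i + x) ` relation_ideal E"
  by (auto simp: presented_class_def a_r_coset_def' free_algebra_def)

lemma mem_presented_class_iff: "y \<in> presented_class E x \<longleftrightarrow> y - x \<in> relation_ideal E"
  by (auto simp: presented_class_eq_image intro: image_eqI[of _ _ "y - x"])

lemma presented_class_eq_iff: "presented_class E x = presented_class E y \<longleftrightarrow> x - y \<in> relation_ideal E"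
proof
  assume "presented_class E x = presented_class E y"
  moreover have "x \<in> presented_class E x" by (simp add: mem_presented_class_iff)
  ultimately show "x - y \<in> relation_ideal E" by (simp add: mem_presented_class_iff)
next
  assume xy: "x - y \<in> relation_ideal E"
  have "z - x \<in> relation_ideal E \<longleftrightarrow> z - y \<in> relation_ideal E" for z
    using relation_ideal_add[OF _ xy, of "z - x"] relation_ideal_diff[OF _ xy, of "z - y"] by auto
  then show "presented_class E x = presented_class E y"
    by (auto simp: mem_presented_class_iff)
qed

text \<open>Functions on the quotient, such as scalar multiplication, are written as unions over a
  coset. The union collapses to one value when the function does not depend on the
  representative.\<close>

lemma UN_presented_class:
  assumes "\<And>x y. x - y \<in> relation_ideal E \<Longrightarrow> h x = h y"
  shows "(\<Union>x\<in>presented_class E y. h x) = h y"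
proof -
  have "y \<in> presented_class E y" by (simp add: mem_presented_class_iff)
  moreover have "h x = h y" if "x \<in> presented_class E y" for x
    using that assms by (simp add: mem_presented_class_iff)
  ultimately show ?thesis by blast
qed

lemma presented_class_ring_hom: "presented_class E \<in> ring_hom free_algebra (free_algebra Quot relation_ideal E)"
  using ideal.rcos_ring_hom[OF ideal_relation_ideal[of E]]
  by (simp add: presented_class_def[abs_def])

lemma carrier_presented_algebra: "carrier (presented_algebra E) = range (presented_class E)"
  by (auto simp: presented_algebra_def ring.defs FactRing_def A_RCOSETS_def'
      presented_class_def free_algebra_def)

lemma mult_presented_class:
  "presented_class E x \<otimes>\<^bsub>presented_algebra E\<^esub> presented_class E y = presented_class E (x * y)"
  using ring_hom_mult[OF presented_class_ring_hom[of E], of x y]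
  by (simp add: presented_algebra_def ring.defs) (simp add: free_algebra_def)

lemma add_presented_class:
  "presented_class E x \<oplus>\<^bsub>presented_algebra E\<^esub> presented_class E y = presented_class E (x + y)"
  using ring_hom_add[OF presented_class_ring_hom[of E], of x y]
  by (simp add: presented_algebra_def ring.defs) (simp add: free_algebra_def)

lemma one_presented_algebra: "\<one>\<^bsub>presented_algebra E\<^esub> = presented_class E 1"
  using ring_hom_one[OF presented_class_ring_hom[of E]]
  by (simp add: presented_algebra_def ring.defs) (simp add: free_algebra_def)

text \<open>Scaling is left multiplication by a constant, so it is well defined on cosets because
  the ideal absorbs left factors.\<close>

lemma smult_presented_class:
  "c \<odot>\<^bsub>presented_algebra E\<^esub> presented_class E x = presented_class E (Poly_Mapping.single 0 c * x)"
proof -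
  have "c \<odot>\<^bsub>presented_algebra E\<^esub> presented_class E x =
      (\<Union>y\<in>presented_class E x. presented_class E (Poly_Mapping.single 0 c * y))"
    by (simp add: presented_algebra_def ring.defs module.defs presented_class_def)
      (simp add: free_algebra_def mult_map_scale_conv_mult)
  also have "\<dots> = presented_class E (Poly_Mapping.single 0 c * x)"
    by (rule UN_presented_class)
      (simp add: presented_class_eq_iff relation_ideal_mult_left flip: right_diff_distrib)
  finally show ?thesis .
qed

section \<open>Isomorphisms from mutually inverse substitutions\<close>

text \<open>The elements fixed modulo the ideal by the composite form a subalgebra, so checking
  generators is enough.\<close>

lemma free_hom_cong_id:
  assumes "\<And>g. free_hom f (h g) - free_gen g \<in> relation_ideal E"
  shows "free_hom f (free_hom h x) - x \<in> relation_ideal E"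
proof (induction x rule: free_alg_induct)
  case (add p q)
  from relation_ideal_add[OF this] show ?case by (simp add: algebra_simps)
next
  case (mult p q)
  have "free_hom f (free_hom h (p * q)) - p * q =
      (free_hom f (free_hom h p) - p) * free_hom f (free_hom h q) + p * (free_hom f (free_hom h q) - q)"
    by (simp add: algebra_simps)
  then show ?case
    using mult by (simp only:) (intro relation_ideal_add relation_ideal_mult_left relation_ideal_mult_right)
qed (simp_all add: assms)

text \<open>By \<open>f\<close> and \<open>g\<close> both substitutions descend to the quotients; by
  \<open>fg\<close> and \<open>gf\<close> the induced maps are inverse to each other.\<close>

lemma presented_algebra_iso:
  assumes f: "\<And>l r. (l, r) \<in> E \<Longrightarrow> free_hom f l - free_hom f r \<in> relation_ideal E'"
    and g: "\<And>l r. (l, r) \<in> E' \<Longrightarrow> free_hom g l - free_hom g r \<in> relation_ideal E"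
    and fg: "\<And>y. free_hom f (g y) - free_gen y \<in> relation_ideal E'"
    and gf: "\<And>x. free_hom g (f x) - free_gen x \<in> relation_ideal E"
  obtains \<phi> where "\<phi> \<in> algebra_iso (presented_algebra E) (presented_algebra E')"
    and "\<And>x. \<phi> (presented_class E x) = presented_class E' (free_hom f x)"
proof
  define \<phi> where "\<phi> X = (\<Union>x\<in>X. presented_class E' (free_hom f x))" for X
  show eq: "\<phi> (presented_class E x) = presented_class E' (free_hom f x)" for x
    unfolding \<phi>_def
  proof (rule UN_presented_class)
    fix x y assume "x - y \<in> relation_ideal E"
    then have "free_hom f (x - y) \<in> relation_ideal E'" using free_hom_relation_ideal f by blast
    then show "presented_class E' (free_hom f x) = presented_class E' (free_hom f y)"
      by (simp add: presented_class_eq_iff)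
  qed
  have hom: "\<phi> \<in> ring_hom (presented_algebra E) (presented_algebra E')"
    by (rule ring_hom_memI)
      (auto simp: carrier_presented_algebra mult_presented_class add_presented_class
        one_presented_algebra eq)
  have inj: "inj_on \<phi> (carrier (presented_algebra E))"
  proof (rule inj_onI, clarsimp simp: carrier_presented_algebra eq)
    fix x y assume "presented_class E' (free_hom f x) = presented_class E' (free_hom f y)"
    then have "free_hom f (x - y) \<in> relation_ideal E'" by (simp add: presented_class_eq_iff)
    then have "free_hom g (free_hom f (x - y)) \<in> relation_ideal E"
      using free_hom_relation_ideal g by blast
    \<comment> \<open>Injectivity: applying \<open>g\<close> returns \<open>x - y\<close> up to an
      element of the ideal.\<close>
    from relation_ideal_diff[OF this free_hom_cong_id[OF gf, of "x - y"]]
    show "presented_class E x = presented_class E y" by (simp add: presented_class_eq_iff)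
  qed
  \<comment> \<open>Surjectivity: \<open>free_hom g y\<close> represents a preimage of the class of
    \<open>y\<close>.\<close>
  have "presented_class E' y = \<phi> (presented_class E (free_hom g y))" for y
    using relation_ideal_uminus[OF free_hom_cong_id[OF fg, of y]]
    by (simp add: eq presented_class_eq_iff)
  then have "carrier (presented_algebra E') \<subseteq> \<phi> ` carrier (presented_algebra E)"
    unfolding carrier_presented_algebra by (metis image_subsetI imageI rangeI)
  then have "\<phi> ` carrier (presented_algebra E) = carrier (presented_algebra E')"
    by (auto simp: carrier_presented_algebra eq)
  with hom inj show "\<phi> \<in> algebra_iso (presented_algebra E) (presented_algebra E')"
    by (auto simp: algebra_iso_def ring_iso_def bij_betw_def carrier_presented_algebra
        smult_presented_class eq)
qed

section \<open>Commutation modulo the relation ideal\<close>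

text \<open>Commutation of two classes in the presented algebra, stated on representatives so that
  calculations stay in the free algebra.\<close>

definition commute_mod ::
  "(('g, 'k::field) free_alg \<times> ('g, 'k) free_alg) set \<Rightarrow> ('g, 'k) free_alg \<Rightarrow> ('g, 'k) free_alg \<Rightarrow> bool" where
  "commute_mod E z x \<longleftrightarrow> z * x - x * z \<in> relation_ideal E"

lemma commute_mod_sym: "commute_mod E z x \<Longrightarrow> commute_mod E x z"
  unfolding commute_mod_def by (drule relation_ideal_uminus) simp

lemma commute_mod_refl: "commute_mod E z z"
  by (simp add: commute_mod_def)

lemma commute_mod_const: "commute_mod E z (Poly_Mapping.single 0 c)"
  by (simp add: commute_mod_def const_commute)

lemma commute_mod_add: "commute_mod E z x \<Longrightarrow> commute_mod E z y \<Longrightarrow> commute_mod E z (x + y)"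
  unfolding commute_mod_def by (drule (1) relation_ideal_add) (simp add: algebra_simps)

lemma commute_mod_diff: "commute_mod E z x \<Longrightarrow> commute_mod E z y \<Longrightarrow> commute_mod E z (x - y)"
  unfolding commute_mod_def by (drule (1) relation_ideal_diff) (simp add: algebra_simps)

text \<open>The commutator with \<open>z\<close> is a derivation: [z, xy] = [z, x]y +
  x[z, y].\<close>

lemma commute_mod_mult:
  assumes "commute_mod E z x" "commute_mod E z y"
  shows "commute_mod E z (x * y)"
proof -
  have "z * (x * y) - x * y * z = (z * x - x * z) * y + x * (z * y - y * z)"
    by (simp add: algebra_simps)
  then show ?thesis
    using assms unfolding commute_mod_def
    by (simp only:) (intro relation_ideal_add relation_ideal_mult_left relation_ideal_mult_right)
qed

text \<open>Commutation depends only on the class. This allows an element to be replaced by an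
  expression that a relation identifies with it.\<close>

lemma commute_mod_cong:
  assumes "x - y \<in> relation_ideal E" "commute_mod E z y"
  shows "commute_mod E z x"
proof -
  have "z * x - x * z = z * (x - y) - (x - y) * z + (z * y - y * z)"
    by (simp add: algebra_simps)
  then show ?thesis
    using assms unfolding commute_mod_def
    by (simp only: relation_ideal_add relation_ideal_diff relation_ideal_mult_left relation_ideal_mult_right)
qed

text \<open>The elements commuting with \<open>z\<close> modulo the ideal form a subalgebra.\<close>

lemma commute_modI:
  assumes "\<And>g. commute_mod E z (free_gen g)"
  shows "commute_mod E z x"
  by (induction x rule: free_alg_induct)
    (simp_all add: assms commute_mod_const commute_mod_add commute_mod_mult)

section \<open>The two presentations of the Racah algebra\<close>

abbreviation "adb_A \<equiv> free_gen Adb_A"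
abbreviation "adb_B \<equiv> free_gen Adb_B"
abbreviation "adb_D \<equiv> free_gen Adb_D"
abbreviation "adb_alpha \<equiv> free_gen Adb_alpha"
abbreviation "adb_beta \<equiv> free_gen Adb_beta"
abbreviation "adb_delta \<equiv> free_gen Adb_delta"

fun adb_to_racah :: "adb_gen \<Rightarrow> 'k::field racah_free" where
  "adb_to_racah Adb_A = racah_A"
| "adb_to_racah Adb_D = racah_D"
| "adb_to_racah Adb_B = racah_B"
| "adb_to_racah Adb_alpha = racah_alpha"
| "adb_to_racah Adb_beta = racah_beta"
| "adb_to_racah Adb_delta = racah_delta"

fun racah_to_adb :: "racah_gen \<Rightarrow> 'k::field adb_free" where
  "racah_to_adb Gen_A = adb_A"
| "racah_to_adb Gen_B = adb_B"
| "racah_to_adb Gen_C = adb_delta - adb_A - adb_B"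
| "racah_to_adb Gen_D = adb_D"

section \<open>The second presentation's relations hold in the Racah algebra\<close>

lemma racah_ideal:
  fixes x :: "'k::field racah_free"
  shows "commutator racah_A racah_B - 2 * racah_D \<in> relation_ideal (racah_relations :: ('k racah_free \<times> _) set)"
    and "commutator racah_B racah_C - 2 * racah_D \<in> relation_ideal (racah_relations :: ('k racah_free \<times> _) set)"
    and "commutator racah_C racah_A - 2 * racah_D \<in> relation_ideal (racah_relations :: ('k racah_free \<times> _) set)"
    and "racah_alpha * x - x * racah_alpha \<in> relation_ideal racah_relations"
    and "racah_beta * x - x * racah_beta \<in> relation_ideal racah_relations"
  by (rule relation_ideal_relation, force simp: racah_relations_def)+

text \<open>The six relations in which \<alpha> or \<beta> commutes with a generator are instances
  of centrality. The other five reduce to the three commutator relations once \<alpha>, \<beta>,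
  \<delta> are expanded.\<close>

lemma adb_to_racah_relation:
  assumes "(l, r) \<in> (adb_relations :: ('k::field adb_free \<times> _) set)"
  shows "free_hom adb_to_racah l - free_hom adb_to_racah r \<in> relation_ideal racah_relations"
proof -
  let ?I = "relation_ideal (racah_relations :: ('k racah_free \<times> _) set)"
  let ?AB = "commutator racah_A racah_B - 2 * racah_D :: 'k racah_free"
  let ?BC = "commutator racah_B racah_C - 2 * racah_D :: 'k racah_free"
  let ?CA = "commutator racah_C racah_A - 2 * racah_D :: 'k racah_free"
  \<comment> \<open>These combinations are, in the same order, the expansions of the five
    differences that follow.\<close>
  have "- ?AB \<in> ?I" "?AB \<in> ?I" "?AB + ?AB - ?BC \<in> ?I" "?CA - ?AB \<in> ?I" "?AB - ?BC \<in> ?I"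
    by (intro relation_ideal_uminus relation_ideal_add relation_ideal_diff racah_ideal)+
  then have
    "racah_B * racah_A - (racah_A * racah_B - 2 * racah_D) \<in> ?I"
    "racah_D * racah_A - (racah_A * racah_D + racah_A * racah_delta - racah_A * racah_A -
      2 * racah_A * racah_B + 2 * racah_D - racah_alpha) \<in> ?I"
    "racah_B * racah_D - (racah_D * racah_B + racah_B * racah_delta - racah_B * racah_B -
      2 * racah_A * racah_B + 2 * racah_D + racah_beta) \<in> ?I"
    "racah_delta * racah_A - racah_A * racah_delta \<in> ?I"
    "racah_delta * racah_B - racah_B * racah_delta \<in> ?I"
    by (simp_all add: racah_alpha_def racah_beta_def racah_delta_def commutator_def algebra_simps
        mult_2 mult_2_right)
  with assms racah_ideal(4,5)[where 'k='k] show ?thesis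
    unfolding adb_relations_def Let_def by (auto simp: power2_eq_square)
qed

section \<open>Central elements in the second presentation\<close>

lemma adb_ideal:
  fixes I defines "I \<equiv> relation_ideal (adb_relations :: ('k::field adb_free \<times> _) set)"
  shows "adb_B * adb_A - (adb_A * adb_B - 2 * adb_D) \<in> I"
    and "adb_D * adb_A - (adb_A * adb_D + adb_A * adb_delta - adb_A ^ 2 - 2 * adb_A * adb_B +
      2 * adb_D - adb_alpha) \<in> I"
    and "adb_B * adb_D - (adb_D * adb_B + adb_B * adb_delta - adb_B ^ 2 - 2 * adb_A * adb_B +
      2 * adb_D + adb_beta) \<in> I"
  unfolding I_def by (rule relation_ideal_relation, simp add: adb_relations_def Let_def)+

lemma adb_commute:
  fixes E defines "E \<equiv> (adb_relations :: ('k::field adb_free \<times> _) set)"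
  shows "commute_mod E adb_alpha adb_A" "commute_mod E adb_alpha adb_B"
    "commute_mod E adb_beta adb_A" "commute_mod E adb_beta adb_B"
    "commute_mod E adb_delta adb_A" "commute_mod E adb_delta adb_B"
    "commute_mod E adb_alpha adb_delta" "commute_mod E adb_beta adb_delta"
  unfolding E_def commute_mod_def
  by (rule relation_ideal_relation, simp add: adb_relations_def Let_def)+

text \<open>If 2 vanished, the characteristic would divide 2; it is never 1, so it would be
  2.\<close>

lemma two_neq_zero:
  assumes "CHAR('k::field) \<noteq> 2"
  shows "(2 :: 'k) \<noteq> 0"
proof
  assume "(2 :: 'k) = 0"
  then have "of_nat 2 = (0 :: 'k)" by simp
  then have "CHAR('k) dvd 2" by (simp only: of_nat_eq_0_iff_char_dvd)
  then have "CHAR('k) \<le> 2" "CHAR('k) \<noteq> 0"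
    by (simp add: dvd_imp_le) (metis \<open>CHAR('k) dvd 2\<close> dvd_0_left_iff zero_neq_numeral)
  then show False using assms CHAR_not_1[where 'a='k] by linarith
qed

text \<open>Modulo the relation for \<open>BA\<close>, the generator \<open>adb_D\<close> is half
  the commutator of \<open>adb_A\<close> and \<open>adb_B\<close>.\<close>

lemma adb_commute_D:
  fixes z :: "'k::field adb_free"
  assumes char: "CHAR('k) \<noteq> 2"
    and A: "commute_mod adb_relations z adb_A" and B: "commute_mod adb_relations z adb_B"
  shows "commute_mod adb_relations z adb_D"
proof (rule commute_mod_cong)
  let ?half = "Poly_Mapping.single 0 (1 / 2) :: 'k adb_free"
  have half: "?half * (adb_D + adb_D) = adb_D"
  proof -
    have "?half * (adb_D + adb_D) = Poly_Mapping.single 0 (1 / 2 + 1 / 2) * adb_D"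
      by (simp only: single_add distrib_left distrib_right)
    also have "1 / 2 + 1 / 2 = (1 :: 'k)"
      using two_neq_zero[OF char] by (simp add: field_simps)
    finally show ?thesis by simp
  qed
  have "adb_D - ?half * (adb_A * adb_B - adb_B * adb_A) =
      ?half * (adb_B * adb_A - (adb_A * adb_B - 2 * adb_D))"
    \<comment> \<open>Rewriting \<open>adb_D\<close> as \<open>?half * (adb_D + adb_D)\<close> lets
      \<open>?half\<close> be treated as an opaque factor in the expansion.\<close>
    by (subst half[symmetric]) (simp add: algebra_simps mult_2)
  then show "adb_D - ?half * (adb_A * adb_B - adb_B * adb_A) \<in> relation_ideal adb_relations"
    by (simp only: relation_ideal_mult_left adb_ideal)
  show "commute_mod adb_relations z (?half * (adb_A * adb_B - adb_B * adb_A))"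
    by (intro commute_mod_mult commute_mod_diff commute_mod_const A B)
qed

text \<open>The relations and \<open>adb_commute_D\<close> settle every pair of generators needed
  except \<alpha> and \<beta>.\<close>

lemma adb_central:
  assumes char: "CHAR('k::field) \<noteq> 2"
  shows "commute_mod adb_relations adb_alpha (x :: 'k adb_free)"
    and "commute_mod adb_relations adb_beta (x :: 'k adb_free)"
    and "commute_mod adb_relations adb_delta (x :: 'k adb_free)"
proof -
  let ?E = "adb_relations :: ('k adb_free \<times> _) set"
  note D = adb_commute_D[OF char]
  have "commute_mod ?E adb_beta adb_alpha"
  proof (rule commute_mod_cong)
    \<comment> \<open>The relation for \<open>DA\<close> solved for \<alpha>; doubles and the square
      are written out as sums and a product to fit the closure rules of
      \<open>commute_mod\<close>.\<close>
    let ?y = "adb_A * adb_D + adb_A * adb_delta - adb_A * adb_A - (adb_A * adb_B + adb_A * adb_B) +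
      (adb_D + adb_D) - adb_D * adb_A :: 'k adb_free"
    show "adb_alpha - ?y \<in> relation_ideal ?E"
      using adb_ideal(2)[where 'k='k]
      by (simp add: algebra_simps mult_2 mult_2_right power2_eq_square)
    show "commute_mod ?E adb_beta ?y"
      by (intro commute_mod_add commute_mod_diff commute_mod_mult D adb_commute)
  qed
  note comm = adb_commute this
  have "commute_mod ?E adb_alpha (free_gen g)" for g
    by (cases g) (auto intro: D comm commute_mod_refl commute_mod_sym)
  then show "commute_mod ?E adb_alpha x" by (rule commute_modI)
  have "commute_mod ?E adb_beta (free_gen g)" for g
    by (cases g) (auto intro: D comm commute_mod_refl commute_mod_sym)
  then show "commute_mod ?E adb_beta x" by (rule commute_modI)
  have "commute_mod ?E adb_delta (free_gen g)" for g
    by (cases g) (auto intro: D comm commute_mod_refl commute_mod_sym)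
  then show "commute_mod ?E adb_delta x" by (rule commute_modI)
qed

section \<open>The Racah relations hold in the second presentation\<close>

lemma racah_to_adb_gen:
  "free_hom racah_to_adb racah_A = adb_A" "free_hom racah_to_adb racah_B = adb_B"
  "free_hom racah_to_adb racah_C = adb_delta - adb_A - adb_B" "free_hom racah_to_adb racah_D = adb_D"
  by (simp_all add: racah_A_def racah_B_def racah_C_def racah_D_def)

text \<open>The difference is minus the sum of the relations for \<open>BA\<close> and
  \<open>DA\<close>, in which the terms 2D cancel.\<close>

lemma racah_to_adb_alpha:
  "free_hom racah_to_adb racah_alpha - adb_alpha \<in> relation_ideal (adb_relations :: ('k::field adb_free \<times> _) set)"
proof -
  note relation_ideal_add[OF adb_ideal(1)[where 'k='k] adb_ideal(2)]
  from relation_ideal_uminus[OF this] show ?thesis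
    by (simp add: racah_alpha_def commutator_def racah_to_adb_gen algebra_simps mult_2 mult_2_right
        power2_eq_square)
qed

text \<open>The relations for \<open>BA\<close> and \<open>BD\<close> add up to the difference,
  except that they contain \<open>B\<close> times \<delta> where the expansion has \<delta> times
  \<open>B\<close>; commutation of \<delta> with \<open>B\<close> corrects this.\<close>

lemma racah_to_adb_beta:
  "free_hom racah_to_adb racah_beta - adb_beta \<in> relation_ideal (adb_relations :: ('k::field adb_free \<times> _) set)"
proof -
  note relation_ideal_add[OF adb_ideal(1)[where 'k='k] adb_ideal(3)]
  from relation_ideal_diff[OF this adb_commute(6)[unfolded commute_mod_def]] show ?thesis
    by (simp add: racah_beta_def commutator_def racah_to_adb_gen algebra_simps mult_2 mult_2_right
        power2_eq_square)
qed

text \<open>No generator corresponds to \<gamma>, so its centrality is obtained by expressing its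
  image through \<alpha> and \<beta>.\<close>

lemma racah_to_adb_gamma:
  assumes char: "CHAR('k::field) \<noteq> 2"
  shows "free_hom racah_to_adb racah_gamma - (- adb_alpha - adb_beta) \<in>
    relation_ideal (adb_relations :: ('k adb_free \<times> _) set)"
proof -
  \<comment> \<open>An identity of the free algebra: in \<alpha> + \<beta> + \<gamma> the terms
    outside the commutators with \<open>racah_D\<close> cancel cyclically.\<close>
  have gamma: "racah_gamma = commutator racah_delta racah_D - racah_alpha - (racah_beta :: 'k racah_free)"
    by (simp add: racah_alpha_def racah_beta_def racah_gamma_def racah_delta_def commutator_def
        algebra_simps)
  have "free_hom racah_to_adb racah_gamma - (- adb_alpha - adb_beta) =
      (adb_delta * adb_D - adb_D * adb_delta) - (free_hom racah_to_adb racah_alpha - adb_alpha) -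
      (free_hom racah_to_adb racah_beta - (adb_beta :: 'k adb_free))"
    by (subst gamma) (simp add: racah_delta_def commutator_def racah_to_adb_gen algebra_simps)
  then show ?thesis
    using adb_central(3)[OF char, of adb_D]
    by (simp only: commute_mod_def relation_ideal_diff racah_to_adb_alpha racah_to_adb_beta)
qed

text \<open>The commutator relations follow from the relation for \<open>BA\<close> and from
  \<delta> commuting with \<open>A\<close> and \<open>B\<close>; the centrality relations follow
  because the images are congruent to \<alpha>, \<beta> and -\<alpha> - \<beta>.\<close>

lemma racah_to_adb_relation:
  assumes char: "CHAR('k::field) \<noteq> 2"
    and lr: "(l, r) \<in> (racah_relations :: ('k racah_free \<times> _) set)"
  shows "free_hom racah_to_adb l - free_hom racah_to_adb r \<in> relation_ideal adb_relations"
proof -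
  let ?I = "relation_ideal (adb_relations :: ('k adb_free \<times> _) set)"
  have central: "commute_mod adb_relations (free_hom racah_to_adb z) (x :: 'k adb_free)"
    if "z \<in> {racah_alpha, racah_beta, racah_gamma}" for z x
  proof -
    have "commute_mod adb_relations x (- adb_alpha - adb_beta)"
      \<comment> \<open>The constant 0 starts the chain: the element is read as 0 - \<alpha> -
        \<beta>.\<close>
      using commute_mod_diff[OF commute_mod_diff[OF commute_mod_const[of _ x 0]]]
        adb_central[OF char, THEN commute_mod_sym]
      by simp
    then show ?thesis
      using that commute_mod_cong[OF racah_to_adb_alpha[where 'k='k]]
        commute_mod_cong[OF racah_to_adb_beta[where 'k='k]]
        commute_mod_cong[OF racah_to_adb_gamma[OF char]] adb_central[OF char, THEN commute_mod_sym]
      by (intro commute_mod_sym[of _ x]) auto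
  qed
  let ?BA = "adb_B * adb_A - (adb_A * adb_B - 2 * adb_D) :: 'k adb_free"
  let ?dA = "adb_delta * adb_A - adb_A * adb_delta :: 'k adb_free"
  let ?dB = "adb_delta * adb_B - adb_B * adb_delta :: 'k adb_free"
  from lr consider "l = commutator racah_A racah_B" "r = 2 * racah_D"
    | "l = commutator racah_B racah_C" "r = 2 * racah_D"
    | "l = commutator racah_C racah_A" "r = 2 * racah_D"
    | z x where "z \<in> {racah_alpha, racah_beta, racah_gamma}" "l = z * x" "r = x * z"
    unfolding racah_relations_def by blast
  then show ?thesis
  proof cases
    case 1
    have "- ?BA \<in> ?I" by (intro relation_ideal_uminus adb_ideal)
    then show ?thesis unfolding 1
      by (simp add: commutator_def racah_to_adb_gen algebra_simps mult_2)
  next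
    case 2
    \<comment> \<open>With \<open>C\<close> replaced by \<delta> - A - B, [B, C] becomes [A, B] -
      [\<delta>, B].\<close>
    have "- ?BA - ?dB \<in> ?I"
      by (intro relation_ideal_uminus relation_ideal_diff adb_ideal adb_commute[unfolded commute_mod_def])
    then show ?thesis unfolding 2
      by (simp add: commutator_def racah_to_adb_gen algebra_simps mult_2)
  next
    case 3
    \<comment> \<open>Likewise [C, A] becomes [A, B] + [\<delta>, A].\<close>
    have "- ?BA + ?dA \<in> ?I"
      by (intro relation_ideal_uminus relation_ideal_add adb_ideal adb_commute[unfolded commute_mod_def])
    then show ?thesis unfolding 3
      by (simp add: commutator_def racah_to_adb_gen algebra_simps mult_2)
  next
    case 4
    then show ?thesis using central unfolding commute_mod_def by simp
  qed
qed

theorem proposition3p4: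
  assumes "CHAR('k::field) \<noteq> 2"
  shows "\<exists>\<phi> \<in> algebra_iso (adb_algebra :: ('k, 'k adb_free set) module)
                         (racah_algebra :: ('k, 'k racah_free set) module).
           \<phi> (presented_class adb_relations (free_gen Adb_A)) = presented_class racah_relations racah_A \<and>
           \<phi> (presented_class adb_relations (free_gen Adb_D)) = presented_class racah_relations racah_D \<and>
           \<phi> (presented_class adb_relations (free_gen Adb_B)) = presented_class racah_relations racah_B \<and>
           \<phi> (presented_class adb_relations (free_gen Adb_alpha)) = presented_class racah_relations racah_alpha \<and>
           \<phi> (presented_class adb_relations (free_gen Adb_beta)) = presented_class racah_relations racah_beta \<and>
           \<phi> (presented_class adb_relations (free_gen Adb_delta)) = presented_class racah_relations racah_delta"
proof -
  \<comment> \<open>This composite fixes every generator exactly, already in the free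
    algebra.\<close>
  have "free_hom adb_to_racah (racah_to_adb g) - free_gen g \<in>
      relation_ideal (racah_relations :: ('k racah_free \<times> _) set)" for g
    by (cases g) (simp_all add: racah_A_def racah_B_def racah_C_def racah_D_def racah_delta_def)
  \<comment> \<open>Here \<alpha> and \<beta> return only modulo the ideal; the other generators
    return exactly.\<close>
  moreover have "free_hom racah_to_adb (adb_to_racah g) - free_gen g \<in>
      relation_ideal (adb_relations :: ('k adb_free \<times> _) set)" for g
    by (cases g) (simp_all add: racah_to_adb_gen racah_to_adb_alpha racah_to_adb_beta racah_delta_def)
  ultimately obtain \<phi> where
    "\<phi> \<in> algebra_iso (presented_algebra (adb_relations :: ('k adb_free \<times> _) set))
      (presented_algebra racah_relations)"
    and "\<And>x. \<phi> (presented_class adb_relations x) = presented_class racah_relations (free_hom adb_to_racah x)"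
    using presented_algebra_iso[OF adb_to_racah_relation racah_to_adb_relation[OF assms]] by blast
  then show ?thesis
    unfolding adb_algebra_def racah_algebra_def by (intro bexI[of _ \<phi>]) simp_all
qed

end
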